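(* For every integer $n\ge0$, $$\sum_{k=0}^{n}{2n+1\brack 2k}_q(-q;q)_{2n-2k}(-1)^kE_{2k}(q)=1,$$ where $E_{2k}(q)=\sum_{\pi\in\mathcal{A}_{2k}}q^{\mathrm{inv}(\pi)}$.
   Context: $\mathcal{A}_m$ is the set of alternating permutations $\pi$ of $[m]$, i.e. those with $\pi_1>\pi_2<\pi_3>\pi_4<\cdots$ (with $\mathcal{A}_0$ consisting of the empty permutation, so $E_0(q)=1$). $\mathrm{inv}(\pi)$ is the number of pairs $i<j$ with $\pi_i>\pi_j$. For a nonnegative integer $m$, $(t;q)_m=\prod_{i=0}^{m-1}(1-tq^i)$ with $(t;q)_0=1$, so $(-q;q)_m=\prod_{j=1}^m(1+q^j)$. The $q$-binomial coefficients are ${n\brack k}_q=\frac{(q;q)_n}{(q;q)_{n-k}(q;q)_k}$ for $0\le k\le n$. *)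

theory Defs
  imports
    "HOL-Combinatorics.Permutations"
    "HOL-Computational_Algebra.Polynomial"
    "HOL-Computational_Algebra.Fraction_Field"
begin

definition q_pochhammer :: "'a::comm_ring_1 \<Rightarrow> 'a \<Rightarrow> nat \<Rightarrow> 'a" where
  "q_pochhammer t q m = (\<Prod>i<m. 1 - t * q ^ i)"

text \<open>
  Meant for \<open>k \<le> n\<close> and for \<open>q\<close> not a root of unity of order at most \<open>n\<close>, so
  that the denominator is nonzero.
\<close>
definition q_binomial :: "'a::field \<Rightarrow> nat \<Rightarrow> nat \<Rightarrow> 'a" where
  "q_binomial q n k =
     q_pochhammer q q n / (q_pochhammer q q (n - k) * q_pochhammer q q k)"

text \<open>
  A permutation of \<open>{1..m}\<close> is a function \<open>\<pi>\<close> on the naturals with \<open>\<pi> permutes {1..m}\<close>,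
  so it is the identity outside \<open>{1..m}\<close>; in particular \<open>id\<close> is the only
  permutation for \<open>m = 0\<close>.
\<close>
definition alternating_perms :: "nat \<Rightarrow> (nat \<Rightarrow> nat) set" where
  "alternating_perms m =
     {\<pi>. \<pi> permutes {1..m} \<and>
          (\<forall>i\<in>{1..<m}. if odd i then \<pi> i > \<pi> (i + 1) else \<pi> i < \<pi> (i + 1))}"

definition inv_count :: "nat \<Rightarrow> (nat \<Rightarrow> nat) \<Rightarrow> nat" where
  "inv_count m \<pi> = card {(i, j). i \<in> {1..m} \<and> j \<in> {1..m} \<and> i < j \<and> \<pi> i > \<pi> j}"

definition q_euler :: "'a::comm_semiring_1 \<Rightarrow> nat \<Rightarrow> 'a" where
  "q_euler q m = (\<Sum>\<pi>\<in>alternating_perms m. q ^ inv_count m \<pi>)"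

text \<open>
  The formal variable \<open>q\<close>, as an element of the fraction field of \<open>\<int>[q]\<close>.
\<close>
definition qvar :: "int poly fract" where
  "qvar = Fract [:0, 1:] 1"

end

theory Submission
  imports Defs "HOL-Library.Infinite_Set"
begin

text \<open>
  Among the arrangements of \<open>2n\<close> letters that alternate on the first \<open>2k\<close> positions and
  decrease afterwards, counted by inversions, each one either ascends at position \<open>2k\<close>, and
  then also alternates on the first \<open>2k + 2\<close> positions, or descends there. The alternating
  sum over \<open>k\<close> telescopes, which makes \<open>(-1)\<^sup>k E\<^sub>2\<^sub>k\<close> inverse to \<open>q\<close> to the power
  \<open>2j choose 2\<close> under \<open>q\<close>-binomial convolution. The \<open>q\<close>-binomial theorem at \<open>t = 1\<close> and
  \<open>t = -1\<close> expands \<open>(-q;q)\<^sub>2\<^sub>m\<close> as the sum of \<open>[2m+1, 2j]\<close> times that power of \<open>q\<close>;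
  inserting this and exchanging sums leaves only the term \<open>1\<close>.
\<close>

section \<open>Gaussian binomial coefficients\<close>

text \<open>Taking a Pascal rule as definition avoids division, so semirings suffice. Of the two
  rules, this one has the factor \<open>q ^ (n - k)\<close> that adjoining a new largest element to
  a \<open>k\<close>-subset contributes. For \<open>k > n\<close> the truncated exponent is
  harmless, since \<open>gauss q n k\<close> is then 0.\<close>

fun gauss :: "'a::comm_semiring_1 \<Rightarrow> nat \<Rightarrow> nat \<Rightarrow> 'a" where
  "gauss q n 0 = 1"
| "gauss q 0 (Suc k) = 0"
| "gauss q (Suc n) (Suc k) = gauss q n (Suc k) + q ^ (n - k) * gauss q n k"

lemma gauss_eq_0: "n < k \<Longrightarrow> gauss q n k = 0"
proof (induction n arbitrary: k)
  case 0
  then show ?case by (cases k) auto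
next
  case (Suc n)
  then show ?case by (cases k) auto
qed

lemma gauss_self [simp]: "gauss q n n = 1"
  by (induction n) (auto simp: gauss_eq_0)

lemma q_pochhammer_Suc: "q_pochhammer t q (Suc m) = q_pochhammer t q m * (1 - t * q ^ m)"
  by (simp add: q_pochhammer_def)

lemma q_pochhammer_0 [simp]: "q_pochhammer t q 0 = 1"
  by (simp add: q_pochhammer_def)

text \<open>The quotient formula cleared of denominators, hence valid in every commutative ring. The
  induction step is \<open>1 - q^(a+b) = (1 - q^a) + q^a * (1 - q^b)\<close> with
  \<open>a = Suc d\<close> and \<open>b = Suc j\<close>.\<close>

lemma gauss_mult_q_pochhammer:
  fixes q :: "'a::comm_ring_1"
  assumes "k \<le> n"
  shows "gauss q n k * (q_pochhammer q q (n - k) * q_pochhammer q q k) = q_pochhammer q q n"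
  using assms
proof (induction n arbitrary: k)
  case 0
  then show ?case by simp
next
  case (Suc n)
  show ?case
  proof (cases k)
    case 0
    then show ?thesis by simp
  next
    case k: (Suc j)
    show ?thesis
    proof (cases "j = n")
      case True
      then show ?thesis by (simp add: k gauss_eq_0)
    next
      case False
      define d where "d = n - Suc j"
      have n: "n = Suc (j + d)" and jn: "Suc j \<le> n"
        using False Suc.prems k by (auto simp: d_def)
      let ?P = "q_pochhammer q q"
      have 1: "gauss q n (Suc j) * (?P d * ?P (Suc j)) = ?P n"
        using Suc.IH[OF jn] by (simp add: d_def)
      have 2: "gauss q n j * (?P (Suc d) * ?P j) = ?P n"
        using Suc.IH[of j] n by simp
      have "gauss q (Suc n) (Suc j) * (?P (Suc d) * ?P (Suc j))
          = (gauss q n (Suc j) * (?P d * ?P (Suc j))) * (1 - q ^ Suc d)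
            + q ^ Suc d * (gauss q n j * (?P (Suc d) * ?P j)) * (1 - q ^ Suc j)"
        by (simp add: n q_pochhammer_Suc algebra_simps)
      also have "\<dots> = ?P n * (1 - q ^ Suc n)"
        unfolding 1 2 by (simp add: n power_add algebra_simps)
      finally show ?thesis
        by (simp add: k n q_pochhammer_Suc)
    qed
  qed
qed

lemma q_binomial_eq_gauss:
  fixes q :: "'a::field"
  assumes "\<And>m. q_pochhammer q q m \<noteq> 0" and "k \<le> n"
  shows "q_binomial q n k = gauss q n k"
  using gauss_mult_q_pochhammer[OF assms(2), of q] assms(1)
  by (simp add: q_binomial_def divide_eq_eq)

text \<open>The even and odd parts of the \<open>q\<close>-binomial theorem at \<open>t = 1\<close>; they agree since
  the product vanishes at \<open>t = -1\<close>.\<close>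

lemma gauss_parity_sums:
  fixes q :: "'a::comm_ring_1"
  defines "c \<equiv> \<lambda>N i. gauss q N i * q ^ (i choose 2)"
  shows "(\<Sum>i\<le>Suc N. if even i then c (Suc N) i else 0) = q_pochhammer (- q) q N \<and>
    (\<Sum>i\<le>Suc N. if odd i then c (Suc N) i else 0) = q_pochhammer (- q) q N"
proof (induction N)
  case 0
  then show ?case by (simp add: c_def binomial_eq_0)
next
  case (Suc N)
  \<comment> \<open>The binomial exponent absorbs the \<open>k\<close> in
    \<open>q ^ (M - k)\<close>: the remaining factor \<open>q ^ M\<close> can leave the sum. On
    generating polynomials in \<open>t\<close> this is multiplication by
    \<open>1 + t * q ^ M\<close>.\<close>
  have c_Suc: "c (Suc M) (Suc k) = c M (Suc k) + q ^ M * c M k" if "k \<le> M" for M k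
  proof -
    have "(M - k) + (Suc k choose 2) = M + (k choose 2)"
      using that by (simp add: numeral_2_eq_2)
    then have "q ^ (M - k) * q ^ (Suc k choose 2) = q ^ M * q ^ (k choose 2)"
      by (simp only: flip: power_add)
    then have "gauss q M k * (q ^ (M - k) * q ^ (Suc k choose 2)) = gauss q M k * (q ^ M * q ^ (k choose 2))"
      by simp
    then show ?thesis
      by (simp add: c_def algebra_simps)
  qed
  \<comment> \<open>Shifting the index exchanges the parities, so each new parity sum is the old one
    plus \<open>q ^ M\<close> times the other. This is why both are proved in one induction.\<close>
  have rec: "(\<Sum>i\<le>Suc M. if P i then c (Suc M) i else 0)
      = (\<Sum>i\<le>M. if P i then c M i else 0) + q ^ M * (\<Sum>i\<le>M. if P (Suc i) then c M i else 0)"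
    for M P
  proof -
    have "(\<Sum>i\<le>Suc M. if P i then c (Suc M) i else 0)
        = (if P 0 then 1 else 0) + (\<Sum>i\<le>M. if P (Suc i) then c (Suc M) (Suc i) else 0)"
      by (simp only: sum.atMost_Suc_shift) (simp add: c_def binomial_eq_0)
    also have "(\<Sum>i\<le>M. if P (Suc i) then c (Suc M) (Suc i) else 0)
       = (\<Sum>i\<le>M. if P (Suc i) then c M (Suc i) else 0)
         + q ^ M * (\<Sum>i\<le>M. if P (Suc i) then c M i else 0)"
      unfolding sum_distrib_left sum.distrib[symmetric]
      by (intro sum.cong) (auto simp: c_Suc)
    also have "(if P 0 then 1 else 0) + \<dots>
       = (\<Sum>i\<le>Suc M. if P i then c M i else 0)
         + q ^ M * (\<Sum>i\<le>M. if P (Suc i) then c M i else 0)"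
      by (simp only: sum.atMost_Suc_shift) (simp add: c_def binomial_eq_0)
    also have "(\<Sum>i\<le>Suc M. if P i then c M i else 0) = (\<Sum>i\<le>M. if P i then c M i else 0)"
      by (simp add: c_def gauss_eq_0)
    finally show ?thesis .
  qed
  show ?case
    unfolding rec[of _ "Suc N"] using Suc
    by (simp add: q_pochhammer_Suc algebra_simps del: sum.atMost_Suc)
qed

lemma gauss_even_sum:
  fixes q :: "'a::comm_ring_1"
  shows "(\<Sum>j\<le>m. gauss q (2 * m + 1) (2 * j) * q ^ (2 * j choose 2)) = q_pochhammer (- q) q (2 * m)"
proof -
  let ?c = "\<lambda>i. gauss q (2 * m + 1) i * q ^ (i choose 2)"
  have "q_pochhammer (- q) q (2 * m) = (\<Sum>i\<le>Suc (2 * m). if even i then ?c i else 0)"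
    using gauss_parity_sums[where q = q and N = "2 * m"]
    by (simp only: Suc_eq_plus1)
  also have "\<dots> = (\<Sum>i | i \<le> Suc (2 * m) \<and> even i. ?c i)"
    by (rule sum.mono_neutral_cong_right) auto
  also have "\<dots> = (\<Sum>j\<le>m. ?c (2 * j))"
    by (rule sum.reindex_bij_witness[of _ "\<lambda>j. 2 * j" "\<lambda>i. i div 2"]) auto
  finally show ?thesis by simp
qed

text \<open>The exponent counts the inversions between \<open>S\<close> and its complement when
  \<open>S\<close> is written first. Splitting by whether the largest element \<open>N\<close> lies
  in \<open>S\<close> gives the recursion of \<open>gauss\<close>: outside \<open>S\<close> it forms
  no pair, inside it forms one with each of the \<open>N - b\<close> elements left out.\<close>

lemma sum_subsets_cross_inversions:
  "(\<Sum>S | S \<subseteq> {..<N} \<and> card S = a. q ^ card {(s, t). s \<in> S \<and> t \<in> {..<N} - S \<and> t < s})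
    = gauss q N a"
proof (induction N arbitrary: a)
  case 0
  have *: "{S :: nat set. S \<subseteq> {..<0} \<and> card S = a} = (if a = 0 then {{}} else {})"
    by auto
  show ?case unfolding * by (cases a) auto
next
  case (Suc N)
  define \<C> :: "nat \<Rightarrow> nat \<Rightarrow> nat set set" where "\<C> M b = {S. S \<subseteq> {..<M} \<and> card S = b}" for M b
  define x where "x M S = card {(s, t). s \<in> S \<and> t \<in> {..<M} - S \<and> t < s}" for M and S :: "nat set"
  have IH: "(\<Sum>S\<in>\<C> N b. q ^ x N S) = gauss q N b" for b
    using Suc.IH[of b] by (simp add: \<C>_def x_def)
  have fin: "finite (\<C> M b)" for M b
    by (rule finite_subset[of _ "Pow {..<M}"]) (auto simp: \<C>_def)
  have x_same: "x (Suc N) S = x N S" if "S \<subseteq> {..<N}" for S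
    unfolding x_def using that by (intro arg_cong[of _ _ card]) auto
  have "(\<Sum>S\<in>\<C> (Suc N) a. q ^ x (Suc N) S) = gauss q (Suc N) a"
  proof (cases a)
    case 0
    then have "\<C> (Suc N) a = {{}}"
      by (auto simp: \<C>_def card_eq_0_iff dest: infinite_super)
    then show ?thesis by (simp add: 0 x_def)
  next
    case a: (Suc b)
    have x_insert: "x (Suc N) (insert N S) = (N - b) + x N S" if "S \<in> \<C> N b" for S
    proof -
      have S: "S \<subseteq> {..<N}" "card S = b" "finite S"
        using that finite_subset[OF _ finite_lessThan] by (auto simp: \<C>_def)
      have "{(s, t). s \<in> insert N S \<and> t \<in> {..<Suc N} - insert N S \<and> t < s}
         = (Pair N ` ({..<N} - S)) \<union> {(s, t). s \<in> S \<and> t \<in> {..<N} - S \<and> t < s}"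
        using S by auto
      also have "card \<dots> = card (Pair N ` ({..<N} - S)) + x N S"
        unfolding x_def
      proof (rule card_Un_disjoint)
        show "finite {(s, t). s \<in> S \<and> t \<in> {..<N} - S \<and> t < s}"
          by (rule finite_subset[of _ "S \<times> {..<N}"]) (use S in auto)
      qed (use S in auto)
      also have "card (Pair N ` ({..<N} - S)) = N - b"
        using S by (simp add: card_image inj_on_def card_Diff_subset)
      finally show ?thesis by (simp add: x_def)
    qed
    have "\<C> (Suc N) a = \<C> N a \<union> insert N ` \<C> N b"
    proof (intro equalityI subsetI)
      fix S assume S: "S \<in> \<C> (Suc N) a"
      show "S \<in> \<C> N a \<union> insert N ` \<C> N b"
      proof (cases "N \<in> S")
        case True
        then have "S - {N} \<in> \<C> N b" "S = insert N (S - {N})"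
          using S by (auto simp: \<C>_def a less_Suc_eq)
        then show ?thesis by blast
      next
        case False
        then show ?thesis using S by (auto simp: \<C>_def less_Suc_eq)
      qed
    next
      fix S assume "S \<in> \<C> N a \<union> insert N ` \<C> N b"
      then show "S \<in> \<C> (Suc N) a"
      proof
        assume "S \<in> insert N ` \<C> N b"
        then obtain T where T: "T \<subseteq> {..<N}" "card T = b" "S = insert N T"
          by (auto simp: \<C>_def)
        moreover have "finite T" "N \<notin> T"
          using T finite_subset[OF _ finite_lessThan] by auto
        ultimately show ?thesis by (auto simp: \<C>_def a)
      qed (auto simp: \<C>_def)
    qed
    moreover have "inj_on (insert N) (\<C> N b)"
      by (rule inj_onI) (auto simp: \<C>_def dest!: insert_ident[THEN iffD1, rotated 2])
    ultimately have "(\<Sum>S\<in>\<C> (Suc N) a. q ^ x (Suc N) S)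
       = (\<Sum>S\<in>\<C> N a. q ^ x (Suc N) S) + (\<Sum>S\<in>\<C> N b. q ^ x (Suc N) (insert N S))"
      by (simp only:) (subst sum.union_disjoint, auto simp: fin sum.reindex, auto simp: \<C>_def)
    also have "(\<Sum>S\<in>\<C> N a. q ^ x (Suc N) S) = gauss q N a"
      unfolding IH[symmetric] by (intro sum.cong refl) (simp add: x_same \<C>_def)
    also have "(\<Sum>S\<in>\<C> N b. q ^ x (Suc N) (insert N S)) = q ^ (N - b) * gauss q N b"
      unfolding IH[symmetric] sum_distrib_left
      by (intro sum.cong refl) (simp add: x_insert power_add)
    finally show ?thesis by (simp add: a)
  qed
  then show ?case by (simp add: \<C>_def x_def)
qed

section \<open>Inversions of lists\<close>

text \<open>Words replace permutations here because they can be cut and concatenated.\<close>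

definition inversions :: "'a::linorder list \<Rightarrow> nat" where
  "inversions xs = card {(i, j). i < j \<and> j < length xs \<and> xs ! j < xs ! i}"

lemma inversions_Nil [simp]: "inversions [] = 0"
  by (simp add: inversions_def)

lemma inversions_Cons:
  "inversions (x # xs) = length (filter (\<lambda>y. y < x) xs) + inversions xs"
proof -
  let ?I = "{(i, j). i < j \<and> j < length xs \<and> xs ! j < xs ! i}"
  let ?J = "{j. j < length xs \<and> xs ! j < x}"
  have "{(i, j). i < j \<and> j < length (x # xs) \<and> (x # xs) ! j < (x # xs) ! i}
      = (\<lambda>j. (0::nat, Suc j)) ` ?J \<union> map_prod Suc Suc ` ?I" (is "?L = ?R")
  proof (intro equalityI subsetI)
    fix p assume "p \<in> ?L"
    then obtain i j where p: "p = (i, Suc j)" "i < Suc j" "j < length xs" "xs ! j < (x # xs) ! i"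
      by (cases p; cases "snd p") auto
    then show "p \<in> ?R"
      by (cases i) (auto simp: image_iff)
  qed auto
  moreover have fin: "finite ?I"
    by (rule finite_subset[of _ "{..<length xs} \<times> {..<length xs}"]) auto
  moreover have "card ((\<lambda>j. (0::nat, Suc j)) ` ?J) = card ?J"
    by (rule card_image) (auto simp: inj_on_def)
  moreover have "card (map_prod Suc Suc ` ?I) = card ?I"
    by (rule card_image) (auto simp: inj_on_def)
  moreover have "card ((\<lambda>j. (0::nat, Suc j)) ` ?J \<union> map_prod Suc Suc ` ?I)
      = card ((\<lambda>j. (0::nat, Suc j)) ` ?J) + card (map_prod Suc Suc ` ?I)"
    by (rule card_Un_disjoint) (use fin in auto)
  ultimately show ?thesis
    by (simp add: inversions_def length_filter_conv_card)
qed

text \<open>Distinctness lets the mixed pairs be counted by values instead of positions, so the last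
  term depends only on the two letter sets.\<close>

lemma inversions_append:
  assumes "distinct xs" and "distinct ys"
  shows "inversions (xs @ ys) = inversions xs + inversions ys
    + card {(s, t). s \<in> set xs \<and> t \<in> set ys \<and> t < s}"
  using assms(1)
proof (induction xs)
  case Nil
  then show ?case by simp
next
  case (Cons x xs)
  have "{(s, t). s \<in> set (x # xs) \<and> t \<in> set ys \<and> t < s}
      = Pair x ` {t \<in> set ys. t < x} \<union> {(s, t). s \<in> set xs \<and> t \<in> set ys \<and> t < s}"
    by auto
  also have "card \<dots> = card (Pair x ` {t \<in> set ys. t < x})
      + card {(s, t). s \<in> set xs \<and> t \<in> set ys \<and> t < s}"
  proof (rule card_Un_disjoint)
    show "finite {(s, t). s \<in> set xs \<and> t \<in> set ys \<and> t < s}"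
      by (rule finite_subset[of _ "set xs \<times> set ys"]) auto
  qed (use Cons.prems in auto)
  also have "card (Pair x ` {t \<in> set ys. t < x}) = length (filter (\<lambda>y. y < x) ys)"
    using distinct_card[of "filter (\<lambda>y. y < x) ys"] assms(2)
    by (simp add: card_image inj_on_def)
  finally show ?case
    using Cons by (simp add: inversions_Cons)
qed

lemma inversions_decreasing:
  "sorted_wrt (>) xs \<Longrightarrow> inversions xs = length xs choose 2"
  by (induction xs) (auto simp: inversions_Cons numeral_2_eq_2)

lemma inversions_map:
  assumes "strict_mono_on (set xs) f"
  shows "inversions (map f xs) = inversions xs"
  unfolding inversions_def
  by (rule arg_cong[of _ _ card])
     (use assms in \<open>auto simp: strict_mono_on_less\<close>)

section \<open>Alternating arrangements of a set\<close>

text \<open>Indices start at 0, so the descents sit at even indices.\<close>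

definition alternating :: "'a::linorder list \<Rightarrow> bool" where
  "alternating xs \<longleftrightarrow> (\<forall>i. Suc i < length xs \<longrightarrow>
     (if even i then xs ! i > xs ! Suc i else xs ! i < xs ! Suc i))"

text \<open>Arbitrary letter sets are allowed because the alternating beginning of a longer word
  uses only some of its letters.\<close>

definition alt_sum :: "'b::comm_semiring_1 \<Rightarrow> 'a::linorder set \<Rightarrow> 'b" where
  "alt_sum q X = (\<Sum>xs | distinct xs \<and> set xs = X \<and> alternating xs. q ^ inversions xs)"

lemma alternating_map:
  assumes "strict_mono_on (set xs) f"
  shows "alternating (map f xs) \<longleftrightarrow> alternating xs"
  using assms unfolding alternating_def by (auto simp: strict_mono_on_less)

text \<open>An increasing relabelling of the letters preserves all comparisons, hence both
  alternation and the inversion count.\<close>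

lemma alt_sum_image:
  assumes "strict_mono_on X f"
  shows "alt_sum q (f ` X) = alt_sum q X"
proof -
  have inj: "inj_on f X"
    using assms by (rule strict_mono_on_imp_inj_on)
  let ?A = "\<lambda>X. {xs. distinct xs \<and> set xs = X \<and> alternating xs}"
  have "bij_betw (map f) (?A X) (?A (f ` X))"
  proof (intro bij_betw_imageI)
    show "inj_on (map f) (?A X)"
        using inj by (intro inj_on_mapI) (rule inj_on_subset, auto)
    show "map f ` ?A X = ?A (f ` X)"
    proof (intro equalityI subsetI)
      fix ys assume ys: "ys \<in> ?A (f ` X)"
      define xs where "xs = map (inv_into X f) ys"
      have xs: "map f xs = ys" "set xs = X"
        using ys inj by (auto simp: xs_def f_inv_into_f image_image intro!: map_idI)
      then have "xs \<in> ?A X"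
        using ys assms alternating_map[of xs f] by (auto simp: distinct_map)
      then show "ys \<in> map f ` ?A X"
        using xs by blast
    qed (use assms inj alternating_map in \<open>auto simp: distinct_map\<close>)
  qed
  then show ?thesis
    unfolding alt_sum_def
    by (rule sum.reindex_bij_betw[symmetric, THEN trans])
       (use assms in \<open>auto intro!: sum.cong simp: inversions_map\<close>)
qed

lemma alt_sum_card_cong:
  fixes X Y :: "nat set"
  assumes "finite X" and "finite Y" and "card X = card Y"
  shows "alt_sum q X = alt_sum q Y"
proof -
  have *: "alt_sum q Z = alt_sum q {..<card Z}" if "finite Z" for Z :: "nat set"
  proof -
    obtain h where "bij_betw h {..<card Z} Z" "strict_mono_on {..<card Z} h"
      by (rule ex_bij_betw_strict_mono_card[OF \<open>finite Z\<close>])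
    then show ?thesis
      using alt_sum_image[of "{..<card Z}" h q] by (simp add: bij_betw_imp_surj_on)
  qed
  show ?thesis
    using *[of X] *[of Y] assms by simp
qed

text \<open>A permutation is exchanged for its one-line word
  \<open>\<pi> 1, ..., \<pi> m\<close>.\<close>

lemma q_euler_eq_alt_sum: "q_euler q m = alt_sum q {1..m}"
proof -
  let ?l = "\<lambda>\<pi>. map \<pi> [1..<Suc m]"
  let ?A = "{xs. distinct xs \<and> set xs = {1..m} \<and> alternating xs}"
  have set_upt: "set [1..<Suc m] = {1..m}"
    by auto
  have nth: "?l \<pi> ! i = \<pi> (Suc i)" if "i < m" for i and \<pi> :: "nat \<Rightarrow> nat"
    using that by (simp del: upt_Suc)
  have alt: "alternating (?l \<pi>) \<longleftrightarrow>
      (\<forall>i\<in>{1..<m}. if odd i then \<pi> i > \<pi> (i + 1) else \<pi> i < \<pi> (i + 1))" (is "_ \<longleftrightarrow> ?R")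
    for \<pi> :: "nat \<Rightarrow> nat"
  proof -
    \<comment> \<open>Index \<open>i\<close> of the word is position \<open>i + 1\<close> of the
      permutation, which flips the parity in the condition.\<close>
    have "?R \<longleftrightarrow> (\<forall>i. Suc i < m \<longrightarrow>
        (if even i then \<pi> (Suc i) > \<pi> (Suc (Suc i)) else \<pi> (Suc i) < \<pi> (Suc (Suc i))))" (is "_ \<longleftrightarrow> ?R'")
    proof
      assume ?R
      show ?R'
      proof (intro allI impI)
        fix i assume "Suc i < m"
        then show "if even i then \<pi> (Suc i) > \<pi> (Suc (Suc i)) else \<pi> (Suc i) < \<pi> (Suc (Suc i))"
          using \<open>?R\<close>[rule_format, of "Suc i"] by (auto split: if_splits)
      qed
    next
      assume R': ?R'
      show ?R
      proof
        fix i assume "i \<in> {1..<m}"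
        then show "if odd i then \<pi> i > \<pi> (i + 1) else \<pi> i < \<pi> (i + 1)"
          using R'[rule_format, of "i - 1"] by (cases i) (auto split: if_splits)
      qed
    qed
    also have "\<dots> \<longleftrightarrow> alternating (?l \<pi>)"
      unfolding alternating_def by (simp add: nth del: upt_Suc)
    finally show ?thesis by simp
  qed
  have inv: "inversions (?l \<pi>) = inv_count m \<pi>" for \<pi> :: "nat \<Rightarrow> nat"
  proof -
    let ?I = "{(i, j). i < j \<and> j < m \<and> \<pi> (Suc j) < \<pi> (Suc i)}"
    have "{(i, j). i \<in> {1..m} \<and> j \<in> {1..m} \<and> i < j \<and> \<pi> i > \<pi> j} = map_prod Suc Suc ` ?I"
      (is "?L = _")
    proof (intro equalityI subsetI)
      fix p assume p: "p \<in> ?L"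
      then have "p = map_prod Suc Suc (fst p - 1, snd p - 1)" "(fst p - 1, snd p - 1) \<in> ?I"
        by (auto simp: prod_eq_iff)
      then show "p \<in> map_prod Suc Suc ` ?I" by blast
    qed auto
    then have "inv_count m \<pi> = card ?I"
      unfolding inv_count_def
      by (simp only:) (rule card_image[OF inj_on_subset[OF prod.inj_map]], auto)
    also have "\<dots> = inversions (?l \<pi>)"
      unfolding inversions_def
      by (rule arg_cong[of _ _ card]) (auto simp: nth simp del: upt_Suc)
    finally show ?thesis by simp
  qed
  have "bij_betw ?l (alternating_perms m) ?A"
  proof (intro bij_betw_imageI)
    show "inj_on ?l (alternating_perms m)"
    proof (rule inj_onI)
      fix \<pi> \<rho> assume *: "\<pi> \<in> alternating_perms m" "\<rho> \<in> alternating_perms m" "?l \<pi> = ?l \<rho>"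
      then have "\<pi> i = \<rho> i" if "i \<in> {1..m}" for i
        using that set_upt by (metis map_eq_conv)
      moreover have "\<pi> i = \<rho> i" if "i \<notin> {1..m}" for i
        using that * by (simp add: alternating_perms_def permutes_def)
      ultimately show "\<pi> = \<rho>" by blast
    qed
    show "?l ` alternating_perms m = ?A"
    proof (intro equalityI subsetI)
      fix xs assume "xs \<in> ?l ` alternating_perms m"
      then obtain \<pi> where \<pi>: "\<pi> \<in> alternating_perms m" "xs = ?l \<pi>" by blast
      then have "\<pi> permutes {1..m}" by (simp add: alternating_perms_def)
      then have "inj_on \<pi> {1..m}" "\<pi> ` {1..m} = {1..m}"
        by (auto simp: permutes_inj_on permutes_image)
      then have "distinct xs" "set xs = {1..m}"
        unfolding \<pi>(2) distinct_map set_map set_upt by auto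
      moreover have "alternating xs"
        using \<pi> alt[of \<pi>] unfolding alternating_perms_def by blast
      ultimately show "xs \<in> ?A" by simp
    next
      fix xs assume "xs \<in> ?A"
      then have xs: "distinct xs" "set xs = {1..m}" "alternating xs" "length xs = m"
        using distinct_card[of xs] by auto
      \<comment> \<open>The inverse map reads the values off the word and extends by the identity,
        as \<open>permutes\<close> demands.\<close>
      define \<pi> where "\<pi> i = (if i \<in> {1..m} then xs ! (i - 1) else i)" for i
      have l: "?l \<pi> = xs"
        by (rule nth_equalityI) (simp_all add: xs(4) nth \<pi>_def del: upt_Suc)
      have "\<pi> permutes {1..m}"
      proof (rule bij_imp_permutes)
        show "bij_betw \<pi> {1..m} {1..m}"
          unfolding bij_betw_def
          using xs(1,2) l distinct_map[of \<pi> "[1..<Suc m]"] set_map[of \<pi> "[1..<Suc m]"]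
          unfolding set_upt by simp
      qed (auto simp: \<pi>_def)
      then have "\<pi> \<in> alternating_perms m"
        using alt[of \<pi>] xs(3) l unfolding alternating_perms_def by auto
      then show "xs \<in> ?l ` alternating_perms m"
        using l by blast
    qed
  qed
  then have "(\<Sum>\<pi>\<in>alternating_perms m. q ^ inversions (?l \<pi>)) = alt_sum q {1..m}"
    unfolding alt_sum_def by (rule sum.reindex_bij_betw)
  then show ?thesis
    by (simp only: q_euler_def inv)
qed

lemma alt_sum_eq_q_euler: "finite X \<Longrightarrow> alt_sum q X = q_euler q (card X)" for X :: "nat set"
  unfolding q_euler_eq_alt_sum by (rule alt_sum_card_cong) auto

lemma q_euler_0 [simp]: "q_euler q 0 = 1"
proof -
  have "{xs :: nat list. distinct xs \<and> set xs = {} \<and> alternating xs} = {[]}"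
    by (auto simp: alternating_def)
  then show ?thesis
    by (simp add: q_euler_eq_alt_sum alt_sum_def)
qed

text \<open>Such a word is fixed by its first \<open>a\<close> letters. Grouped by their set
  \<open>S\<close>, the inversions have three sources: those within the beginning sum to
  \<open>q_euler q a\<close>, the decreasing end always has \<open>N - a choose 2\<close>, and the
  mixed ones sum over \<open>S\<close> to \<open>gauss q N a\<close>.\<close>

lemma sum_alternating_then_decreasing:
  assumes "a \<le> N"
  shows "(\<Sum>xs | distinct xs \<and> set xs = {..<N} \<and> alternating (take a xs) \<and> sorted_wrt (>) (drop a xs).
      q ^ inversions xs) = gauss q N a * q ^ (N - a choose 2) * q_euler q a"
proof -
  define D where "D = {ys. distinct ys \<and> set ys \<subseteq> {..<N} \<and> length ys = a \<and> alternating ys}"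
  \<comment> \<open>The only decreasing arrangement of the letters that \<open>ys\<close> leaves
    over.\<close>
  define dec where "dec ys = rev (sorted_list_of_set ({..<N} - set ys))" for ys
  define x where "x S = card {(s, t). s \<in> S \<and> t \<in> {..<N} - S \<and> t < s}" for S
  have dec: "distinct (dec ys)" "set (dec ys) = {..<N} - set ys" "sorted_wrt (>) (dec ys)" for ys
    by (simp_all add: dec_def sorted_wrt_rev)
  have "(\<Sum>xs | distinct xs \<and> set xs = {..<N} \<and> alternating (take a xs) \<and> sorted_wrt (>) (drop a xs).
      q ^ inversions xs) = (\<Sum>ys\<in>D. q ^ inversions (ys @ dec ys))"
  proof (rule sum.reindex_bij_witness[of _ "\<lambda>ys. ys @ dec ys" "take a"])
    fix xs assume "xs \<in> {xs. distinct xs \<and> set xs = {..<N} \<and> alternating (take a xs)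
      \<and> sorted_wrt (>) (drop a xs)}"
    then have xs: "distinct xs" "set xs = {..<N}" "alternating (take a xs)"
        "sorted_wrt (>) (drop a xs)" "length xs = N"
      using distinct_card[of xs] by auto
    have "set (take a xs) \<inter> set (drop a xs) = {}" "set (take a xs) \<union> set (drop a xs) = {..<N}"
      using xs(1,2) distinct_append[of "take a xs" "drop a xs"] set_append[of "take a xs" "drop a xs"]
      by simp_all
    then have "set (drop a xs) = {..<N} - set (take a xs)" by blast
    \<comment> \<open>Both ends are reversed so that uniqueness of increasing lists applies.\<close>
    then have "set (rev (drop a xs)) = set (rev (dec (take a xs)))"
      by (simp add: dec)
    moreover have "sorted (rev (drop a xs))"
      using xs(4) by (auto simp: sorted_wrt_rev intro: sorted_wrt_mono_rel[rotated])
    moreover have "sorted (rev (dec (take a xs)))"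
      by (simp add: dec_def)
    ultimately have "rev (drop a xs) = rev (dec (take a xs))"
      using xs(1) dec(1) by (intro sorted_distinct_set_unique) auto
    then have "drop a xs = dec (take a xs)" by simp
    then show *: "take a xs @ dec (take a xs) = xs"
      by (metis append_take_drop_id)
    then show "q ^ inversions (take a xs @ dec (take a xs)) = q ^ inversions xs" by simp
    show "take a xs \<in> D"
      using xs assms set_take_subset[of a xs] by (auto simp: D_def)
  next
    fix ys assume "ys \<in> D"
    then have ys: "distinct ys" "set ys \<subseteq> {..<N}" "length ys = a" "alternating ys"
      by (auto simp: D_def)
    then show "take a (ys @ dec ys) = ys" by simp
    show "ys @ dec ys \<in> {xs. distinct xs \<and> set xs = {..<N} \<and> alternating (take a xs)
      \<and> sorted_wrt (>) (drop a xs)}"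
      using ys by (auto simp: dec)
  qed
  also have "\<dots> = (\<Sum>ys\<in>D. q ^ inversions ys * q ^ (N - a choose 2) * q ^ x (set ys))"
  proof (rule sum.cong[OF refl])
    fix ys assume "ys \<in> D"
    then have ys: "distinct ys" "set ys \<subseteq> {..<N}" "length ys = a"
      by (auto simp: D_def)
    have "length (dec ys) = card ({..<N} - set ys)"
      using distinct_card[OF dec(1)[of ys]] by (simp add: dec(2))
    also have "\<dots> = N - a"
      using ys distinct_card[OF ys(1)] by (simp add: card_Diff_subset)
    finally have len: "length (dec ys) = N - a" .
    have "inversions (ys @ dec ys) = inversions ys + (N - a choose 2) + x (set ys)"
      using inversions_append[OF ys(1) dec(1)] inversions_decreasing[OF dec(3)[of ys]]
      by (simp add: dec(2) x_def len)
    then show "q ^ inversions (ys @ dec ys) = q ^ inversions ys * q ^ (N - a choose 2) * q ^ x (set ys)"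
      by (simp add: power_add)
  qed
  also have "\<dots> = (\<Sum>S | S \<subseteq> {..<N} \<and> card S = a. \<Sum>ys | ys \<in> D \<and> set ys = S.
      q ^ inversions ys * q ^ (N - a choose 2) * q ^ x (set ys))"
  proof (rule sum.group[symmetric])
    show "finite D"
      by (rule finite_subset[OF _ finite_lists_length_eq[of "{..<N}" a]]) (auto simp: D_def)
    show "finite {S. S \<subseteq> {..<N} \<and> card S = a}"
      by (rule finite_subset[of _ "Pow {..<N}"]) auto
    show "set ` D \<subseteq> {S. S \<subseteq> {..<N} \<and> card S = a}"
      by (auto simp: D_def distinct_card)
  qed
  also have "\<dots> = (\<Sum>S | S \<subseteq> {..<N} \<and> card S = a. q ^ x S * (q ^ (N - a choose 2) * q_euler q a))"
  proof (rule sum.cong[OF refl])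
    fix S assume "S \<in> {S. S \<subseteq> {..<N} \<and> card S = a}"
    then have S: "S \<subseteq> {..<N}" "card S = a" "finite S"
      using finite_subset[OF _ finite_lessThan] by auto
    have "(\<Sum>ys | ys \<in> D \<and> set ys = S. q ^ inversions ys * q ^ (N - a choose 2) * q ^ x (set ys))
        = (\<Sum>ys | distinct ys \<and> set ys = S \<and> alternating ys.
            q ^ inversions ys * (q ^ (N - a choose 2) * q ^ x S))"
      using S by (intro sum.cong) (auto simp: D_def distinct_card mult.assoc)
    also have "\<dots> = alt_sum q S * (q ^ (N - a choose 2) * q ^ x S)"
      by (simp add: alt_sum_def sum_distrib_right)
    also have "alt_sum q S = q_euler q a"
      using alt_sum_eq_q_euler[OF S(3)] S(2) by simp
    finally show "(\<Sum>ys | ys \<in> D \<and> set ys = S. q ^ inversions ys * q ^ (N - a choose 2) * q ^ x (set ys))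
        = q ^ x S * (q ^ (N - a choose 2) * q_euler q a)"
      by (simp add: mult_ac)
  qed
  also have "\<dots> = gauss q N a * q ^ (N - a choose 2) * q_euler q a"
    unfolding sum_distrib_right[symmetric]
    using sum_subsets_cross_inversions[of q N a] by (simp add: x_def mult.assoc)
  finally show ?thesis .
qed

section \<open>The telescoping alternating sum\<close>

lemma sum_alternating_signs_telescope:
  fixes b :: "nat \<Rightarrow> 'a::comm_ring_1"
  shows "(\<Sum>k\<le>n. (- 1) ^ k * (b k + b (Suc k))) = b 0 + (- 1) ^ n * b (Suc n)"
  by (induction n) (simp_all add: algebra_simps)

text \<open>
  In the proof, \<open>P k\<close> holds the lists alternating on the first \<open>2k\<close> entries and decreasing
  afterwards, and \<open>B k\<close> those among them that also descend from entry \<open>2k\<close> to entry \<open>2k + 1\<close>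
  (numbered from 1; vacuous for \<open>k = n\<close>). The ascending ones make up \<open>B (k + 1)\<close>, as does all
  of \<open>P 0\<close> for \<open>k = 0\<close>.
\<close>

lemma gauss_q_euler_sum_eq_0:
  fixes q :: "'a::comm_ring_1"
  assumes "n > 0"
  shows "(\<Sum>k\<le>n. gauss q (2 * n) (2 * k) * q ^ (2 * (n - k) choose 2) * ((- 1) ^ k * q_euler q (2 * k))) = 0"
proof -
  define X where "X = {xs. distinct xs \<and> set xs = {..<2 * n}}"
  define alt where "alt xs i \<longleftrightarrow> (if even i then xs ! i > xs ! Suc i else xs ! i < xs ! Suc i)"
    for xs :: "nat list" and i
  define P where "P k = {xs \<in> X. alternating (take (2 * k) xs) \<and> sorted_wrt (>) (drop (2 * k) xs)}" for k
  \<comment> \<open>\<open>B 0\<close> and \<open>B (Suc n)\<close> are set empty so that both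
    boundary terms of the telescope vanish.\<close>
  define B where "B k = (if k = 0 \<or> k > n then {} else
    {xs \<in> X. \<forall>i. Suc i < 2 * n \<longrightarrow> (Suc i < 2 * k \<longrightarrow> alt xs i) \<and> (2 * k \<le> Suc i \<longrightarrow> xs ! i > xs ! Suc i)})" for k
  have len: "length xs = 2 * n" if "xs \<in> X" for xs
    using that distinct_card[of xs] by (simp add: X_def)
  have alternating_take: "alternating (take a xs) \<longleftrightarrow> (\<forall>i. Suc i < a \<longrightarrow> alt xs i)"
    if "a \<le> length xs" for a xs
    using that by (simp add: alternating_def alt_def)
  have sorted_drop: "sorted_wrt (>) (drop a xs) \<longleftrightarrow> (\<forall>i. a \<le> i \<and> Suc i < length xs \<longrightarrow> xs ! i > xs ! Suc i)"
    (is "?L \<longleftrightarrow> ?R") if "a \<le> length xs" for a and xs :: "nat list"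
  proof -
    have "?L \<longleftrightarrow> (\<forall>i. Suc i < length xs - a \<longrightarrow> xs ! (a + i) > xs ! Suc (a + i))"
      using that by (subst sorted_wrt_iff_nth_Suc_transp) (auto intro: transpI)
    also have "\<dots> \<longleftrightarrow> ?R"
    proof
      assume *: "\<forall>i. Suc i < length xs - a \<longrightarrow> xs ! (a + i) > xs ! Suc (a + i)"
      show ?R
      proof (intro allI impI)
        fix i assume "a \<le> i \<and> Suc i < length xs"
        then show "xs ! i > xs ! Suc i"
          using *[rule_format, of "i - a"] by (simp add: Suc_diff_le[symmetric] diff_less_mono)
      qed
    qed auto
    finally show ?thesis .
  qed
  have P: "P k = {xs \<in> X. \<forall>i. Suc i < 2 * n \<longrightarrow>
      (Suc i < 2 * k \<longrightarrow> alt xs i) \<and> (2 * k \<le> i \<longrightarrow> xs ! i > xs ! Suc i)}" if "k \<le> n" for k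
    unfolding P_def using that
    by (intro Collect_cong conj_cong refl) (auto simp: len alternating_take sorted_drop)
  have P_eq: "P k = B k \<union> B (Suc k)" if k: "k \<le> n" for k
  proof (intro equalityI subsetI)
    fix xs assume "xs \<in> P k"
    then have xs: "xs \<in> X" "\<And>i. Suc i < 2 * n \<Longrightarrow> Suc i < 2 * k \<Longrightarrow> alt xs i"
      "\<And>i. Suc i < 2 * n \<Longrightarrow> 2 * k \<le> i \<Longrightarrow> xs ! i > xs ! Suc i"
      using P[OF k] by auto
    have distinct: "xs ! i \<noteq> xs ! Suc i" if "Suc i < 2 * n" for i
      using that len[OF xs(1)] xs(1) by (simp add: X_def nth_eq_iff_index_eq)
    show "xs \<in> B k \<union> B (Suc k)"
    \<comment> \<open>Membership is decided at the junction of the two stretches, index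
      \<open>2 * k - 1\<close> counted from 0. It has no left entry for \<open>k = 0\<close>, where
      the word goes to \<open>B 1\<close> (this needs \<open>n > 0\<close>), and no right entry for
      \<open>k = n\<close>, where it goes to \<open>B n\<close>.\<close>
    proof (cases "k > 0 \<and> (k = n \<or> xs ! (2 * k - 1) > xs ! Suc (2 * k - 1))")
      case True
      have "xs ! i > xs ! Suc i" if "Suc i < 2 * n" "2 * k \<le> Suc i" for i
      proof (cases "2 * k \<le> i")
        case False
        then have "i = 2 * k - 1" using that by simp
        then show ?thesis using True that by auto
      qed (use xs that in blast)
      then have "xs \<in> B k"
        using True k xs by (simp add: B_def)
      then show ?thesis by simp
    next
      case False
      then have kn: "k < n" using k assms by auto
      have "alt xs i" if "Suc i < 2 * Suc k" for i
      proof -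
        have "Suc i < 2 * k \<or> Suc i = 2 * k \<or> i = 2 * k"
          using that by arith
        then consider "Suc i < 2 * k" | "Suc i = 2 * k" | "i = 2 * k" by blast
        then show ?thesis
        proof cases
          case 1
          then show ?thesis using xs kn by simp
        next
          case 2
          then have "odd i" "i = 2 * k - 1" "k > 0" by presburger+
          then show ?thesis
            using False distinct[of i] kn by (auto simp: alt_def)
        next
          \<comment> \<open>The first descent of the decreasing end doubles as the descent that
            alternation requires at the even index \<open>2 * k\<close>.\<close>
          case 3
          then show ?thesis using xs(3)[of i] kn by (simp add: alt_def)
        qed
      qed
      then have "xs \<in> B (Suc k)"
        using xs kn by (simp add: B_def)
      then show ?thesis by simp
    qed
  next
    fix xs assume "xs \<in> B k \<union> B (Suc k)"
    then show "xs \<in> P k"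
    proof
      assume "xs \<in> B k"
      then show ?thesis
        using P[OF k] by (auto simp: B_def split: if_splits)
    next
      assume *: "xs \<in> B (Suc k)"
      then have "k < n" by (auto simp: B_def split: if_splits)
      have "xs ! i > xs ! Suc i" if "Suc i < 2 * n" "2 * k \<le> i" for i
      proof (cases "i = 2 * k")
        case True
        then have "alt xs i" using * that by (auto simp: B_def split: if_splits)
        then show ?thesis using True by (simp add: alt_def)
      next
        case False
        then show ?thesis using * that by (auto simp: B_def split: if_splits)
      qed
      moreover have "xs \<in> X" "alt xs i" if "Suc i < 2 * k" for i
        using * that \<open>k < n\<close> by (auto simp: B_def)
      moreover have "xs \<in> X"
        using * by (auto simp: B_def split: if_splits)
      ultimately show ?thesis
        using P[OF k] by auto
    qed
  qed
  have disjoint: "B k \<inter> B (Suc k) = {}" for k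
  proof (rule ccontr)
    assume "B k \<inter> B (Suc k) \<noteq> {}"
    then obtain xs where xs: "xs \<in> B k" "xs \<in> B (Suc k)" by blast
    then have k: "0 < k" "k < n" by (auto simp: B_def split: if_splits)
    \<comment> \<open>At this odd index \<open>B k\<close> forces a descent and
      \<open>B (Suc k)\<close> an ascent.\<close>
    define i where "i = 2 * k - 1"
    have i: "Suc i < 2 * n" "2 * k \<le> Suc i" "Suc i < 2 * Suc k" "odd i"
      using k by (auto simp: i_def)
    have "xs ! i > xs ! Suc i"
      using xs(1) k i by (simp add: B_def)
    moreover have "alt xs i"
      using xs(2) k i by (simp add: B_def)
    ultimately show False
      using i by (simp add: alt_def)
  qed
  have fin: "finite (B k)" for k
  proof (rule finite_subset)
    show "B k \<subseteq> {xs. set xs \<subseteq> {..<2 * n} \<and> length xs = 2 * n}"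
      using len by (auto simp: B_def X_def)
    show "finite {xs. set xs \<subseteq> {..<2 * n} \<and> length xs = 2 * n}"
      by (rule finite_lists_length_eq) simp
  qed
  define b where "b k = (\<Sum>xs\<in>B k. q ^ inversions xs)" for k
  have "(\<Sum>k\<le>n. gauss q (2 * n) (2 * k) * q ^ (2 * (n - k) choose 2) * ((- 1) ^ k * q_euler q (2 * k)))
      = (\<Sum>k\<le>n. (- 1) ^ k * (b k + b (Suc k)))"
  proof (rule sum.cong[OF refl])
    fix k assume "k \<in> {..n}"
    then have k: "k \<le> n" by simp
    have "gauss q (2 * n) (2 * k) * q ^ (2 * n - 2 * k choose 2) * q_euler q (2 * k)
        = (\<Sum>xs\<in>P k. q ^ inversions xs)"
      using sum_alternating_then_decreasing[of "2 * k" "2 * n" q] k by (simp add: P_def X_def conj_assoc)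
    also have "\<dots> = b k + b (Suc k)"
      unfolding P_eq[OF k] b_def by (rule sum.union_disjoint[OF fin fin disjoint])
    finally show "gauss q (2 * n) (2 * k) * q ^ (2 * (n - k) choose 2) * ((- 1) ^ k * q_euler q (2 * k))
        = (- 1) ^ k * (b k + b (Suc k))"
      by (simp add: diff_mult_distrib2 mult.assoc mult.left_commute[of _ "(- 1) ^ k"])
  qed
  also have "\<dots> = 0"
    by (simp add: sum_alternating_signs_telescope) (simp add: b_def B_def)
  finally show ?thesis .
qed

section \<open>The convolution identity\<close>

text \<open>Both sides are the \<open>q\<close>-trinomial coefficient for parts \<open>k\<close>,
  \<open>j\<close> and \<open>n - k - j\<close>: times the common denominator each gives
  \<open>q_pochhammer q q n\<close>, and that denominator cancels in a domain.\<close>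

lemma gauss_mult_gauss:
  fixes q :: "'a::idom"
  assumes "\<And>m. q_pochhammer q q m \<noteq> 0" and "k + j \<le> n"
  shows "gauss q n k * gauss q (n - k) j = gauss q n (k + j) * gauss q (k + j) k"
proof -
  let ?P = "q_pochhammer q q"
  let ?d = "?P (n - k - j) * ?P j * ?P k"
  have "gauss q n k * gauss q (n - k) j * ?d
      = gauss q n k * ((gauss q (n - k) j * (?P (n - k - j) * ?P j)) * ?P k)"
    by (simp add: mult_ac)
  also have "\<dots> = ?P n"
    using assms(2) gauss_mult_q_pochhammer[of j "n - k" q] gauss_mult_q_pochhammer[of k n q] by simp
  also have "\<dots> = gauss q n (k + j) * (?P (n - (k + j)) * (gauss q (k + j) k * (?P (k + j - k) * ?P k)))"
    using assms(2) gauss_mult_q_pochhammer[of k "k + j" q] gauss_mult_q_pochhammer[of "k + j" n q]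
    by simp
  also have "\<dots> = gauss q n (k + j) * gauss q (k + j) k * ?d"
    by (simp add: mult_ac)
  finally show ?thesis
    using assms(1) by simp
qed

lemma gauss_q_pochhammer_q_euler_sum:
  fixes q :: "'a::idom"
  assumes "\<And>m. q_pochhammer q q m \<noteq> 0"
  shows "(\<Sum>k\<le>n. gauss q (2 * n + 1) (2 * k) * q_pochhammer (- q) q (2 * (n - k))
    * ((- 1) ^ k * q_euler q (2 * k))) = 1"
proof -
  let ?a = "\<lambda>k. (- 1) ^ k * q_euler q (2 * k)"
  let ?f = "\<lambda>k j. gauss q (2 * n + 1) (2 * (k + j)) *
    (gauss q (2 * (k + j)) (2 * k) * q ^ (2 * j choose 2) * ?a k)"
  have "(\<Sum>k\<le>n. gauss q (2 * n + 1) (2 * k) * q_pochhammer (- q) q (2 * (n - k)) * ?a k)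
      = (\<Sum>k\<le>n. \<Sum>j\<le>n - k. ?f k j)"
  proof (rule sum.cong[OF refl])
    fix k assume k: "k \<in> {..n}"
    have "gauss q (2 * n + 1) (2 * k) * q_pochhammer (- q) q (2 * (n - k)) * ?a k
      = (\<Sum>j\<le>n - k. (gauss q (2 * n + 1) (2 * k) * gauss q (2 * (n - k) + 1) (2 * j))
          * q ^ (2 * j choose 2) * ?a k)"
      unfolding gauss_even_sum[symmetric] sum_distrib_left sum_distrib_right
      by (simp add: mult.assoc)
    also have "\<dots> = (\<Sum>j\<le>n - k. ?f k j)"
    proof (rule sum.cong[OF refl])
      fix j assume "j \<in> {..n - k}"
      then have "2 * k + 2 * j \<le> 2 * n + 1" "2 * (n - k) + 1 = 2 * n + 1 - 2 * k"
        using k by auto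
      then have "gauss q (2 * n + 1) (2 * k) * gauss q (2 * (n - k) + 1) (2 * j)
          = gauss q (2 * n + 1) (2 * (k + j)) * gauss q (2 * (k + j)) (2 * k)"
        using gauss_mult_gauss[OF assms, of "2 * k" "2 * j" "2 * n + 1"] by (simp only: distrib_left)
      then show "(gauss q (2 * n + 1) (2 * k) * gauss q (2 * (n - k) + 1) (2 * j))
          * q ^ (2 * j choose 2) * ?a k = ?f k j"
        by (simp only: mult.assoc)
    qed
    finally show "gauss q (2 * n + 1) (2 * k) * q_pochhammer (- q) q (2 * (n - k)) * ?a k
      = (\<Sum>j\<le>n - k. ?f k j)" .
  qed
  also have "\<dots> = (\<Sum>(k, j)\<in>{(k, j). k + j \<le> n}. ?f k j)"
    by (subst sum.Sigma) (auto intro!: sum.cong)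
  \<comment> \<open>With \<open>s = k + j\<close> the outer coefficient no longer depends on
    \<open>k\<close>, and the inner sum becomes the vanishing convolution.\<close>
  also have "\<dots> = (\<Sum>s\<le>n. \<Sum>k\<le>s. ?f k (s - k))"
    by (rule sum.triangle_reindex_eq)
  also have "\<dots> = (\<Sum>s\<le>n. gauss q (2 * n + 1) (2 * s) *
      (\<Sum>k\<le>s. gauss q (2 * s) (2 * k) * q ^ (2 * (s - k) choose 2) * ?a k))"
    unfolding sum_distrib_left by (intro sum.cong refl) simp
  \<comment> \<open>The convolution is 0 for \<open>s > 0\<close>; the summand at
    \<open>s = 0\<close> equals 1.\<close>
  also have "\<dots> = (\<Sum>s\<le>n. if s = 0 then 1 else 0)"
    by (intro sum.cong refl) (auto simp: gauss_q_euler_sum_eq_0 binomial_eq_0)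
  finally show ?thesis by simp
qed

section \<open>Specialization to the formal variable\<close>

lemma qvar_power: "qvar ^ i = Fract (monom 1 i) 1"
  by (induction i) (simp_all add: qvar_def One_fract_def monom_Suc)

text \<open>A positive power of the variable is a monomial of positive degree, so it differs from 1
  and no factor vanishes.\<close>

lemma q_pochhammer_qvar_neq_0: "q_pochhammer qvar qvar m \<noteq> 0"
proof -
  have "1 - qvar * qvar ^ i \<noteq> 0" for i
  proof
    assume "1 - qvar * qvar ^ i = 0"
    then have "qvar ^ Suc i = 1" by simp
    then have "monom (1 :: int) (Suc i) = 1"
      by (simp only: qvar_power One_fract_def) (simp add: eq_fract)
    then have "degree (monom (1 :: int) (Suc i)) = degree (1 :: int poly)" by simp
    then show False by (simp add: degree_monom_eq)
  qed
  then show ?thesis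
    by (simp add: q_pochhammer_def)
qed

theorem theorem5p1:
  fixes n :: nat
  shows "(\<Sum>k=0..n. q_binomial qvar (2 * n + 1) (2 * k)
            * q_pochhammer (- qvar) qvar (2 * n - 2 * k)
            * (- 1) ^ k * q_euler qvar (2 * k)) = 1"
proof -
  have "(\<Sum>k=0..n. q_binomial qvar (2 * n + 1) (2 * k) * q_pochhammer (- qvar) qvar (2 * n - 2 * k)
            * (- 1) ^ k * q_euler qvar (2 * k))
      = (\<Sum>k\<le>n. gauss qvar (2 * n + 1) (2 * k) * q_pochhammer (- qvar) qvar (2 * (n - k))
            * ((- 1) ^ k * q_euler qvar (2 * k)))"
    unfolding atMost_atLeast0
    by (intro sum.cong refl)
       (simp add: q_binomial_eq_gauss[OF q_pochhammer_qvar_neq_0] diff_mult_distrib2 mult.assoc)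
  also have "\<dots> = 1"
    by (rule gauss_q_pochhammer_q_euler_sum[OF q_pochhammer_qvar_neq_0])
  finally show ?thesis .
qed

end
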